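(* Let $V,V'$ be Lie superalgebras over a field $K$ and let $\phi:V\to V'$ be a surjective anti-homomorphism of Lie superalgebras. If $A=(\lambda_A,\rho_A)$ and $B=(\lambda_B,\rho_B)$ are anti-CIF ideals of $V$ such that $A$ is homogeneous with $B$, then $\phi(A+B)=\phi(A)+\phi(B)$, and this CIF set of $V'$ is also an anti-CIF ideal of $V'$.
   Context: Complex numbers in the closed unit disk are written $\alpha e^{i2\pi\beta}$ with $\alpha,\beta\in[0,1]$ and are handled through the pair $(\alpha,\beta)$: $\alpha e^{i2\pi\beta}\le\gamma e^{i2\pi\delta}$ means $\alpha\le\gamma$ and $\beta\le\delta$. The symbols $\wedge$ (min), $\vee$ (max), $\sup$, $\inf$ are taken componentwise on such pairs. The value $1$ stands for $1e^{i2\pi\cdot 1}$ and $0$ for $0e^{i2\pi\cdot 0}$. A complex intuitionistic fuzzy (CIF) set on a nonempty set $X$ is a pair $A=(\lambda_A,\rho_A)$ of functions $\lambda_A(x)=r_A(x)e^{i2\pi\omega_A(x)}$, $\rho_A(x)=\hat r_A(x)e^{i2\pi\hat\omega_A(x)}$ with $r_A,\omega_A,\hat r_A,\hat\omega_A:X\to[0,1]$ and $r_A(x)+\hat r_A(x)\le 1$ for all $x$. Equality of CIF sets is equality of the component functions. For CIF sets $A,B$ on $V$, $A$ is homogeneous with $B$ if for all $x,y\in V$: $r_A(x)\le r_B(y)$ if and only if $\omega_A(x)\le\omega_B(y)$; and $\hat r_A(x)\le\hat r_B(y)$ if and only if $\hat\omega_A(x)\le\hat\omega_B(y)$. The complex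 intuitionistic sum $A+B$ is given by $$\lambda_{A+B}(x)=\sup_{x=a+b}\{r_A(a)\wedge r_B(b)\}\,e^{i2\pi\sup_{x=a+b}\{\omega_A(a)\wedge\omega_B(b)\}},$$ $$\rho_{A+B}(x)=\inf_{x=a+b}\{\hat r_A(a)\vee\hat r_B(b)\}\,e^{i2\pi\inf_{x=a+b}\{\hat\omega_A(a)\vee\hat\omega_B(b)\}},$$ where $a,b$ range over all elements of the vector space with $x=a+b$; $\phi(A)+\phi(B)$ is given by the same formulas on $V'$. A CIF set $A$ on a $K$-vector space $V$ is a CIF vector subspace of $V$ if for all $x,y\in V$, $\alpha\in K$: $\lambda_A(x+y)\ge\lambda_A(x)\wedge\lambda_A(y)$, $\rho_A(x+y)\le\rho_A(x)\vee\rho_A(y)$, $\lambda_A(\alpha x)\ge\lambda_A(x)$, $\rho_A(\alpha x)\le\rho_A(x)$; moreover it is always assumed that $\lambda_A(0)=1$ and $\rho_A(0)=0$. A Lie superalgebra over $K$ is a $\mathbb{Z}_2$-graded vector space $V=V_0+V_1$ (direct sum) with a bilinear bracket $[\,,]:V\times V\to V$ such that $[V_i,V_j]\subseteq V_{i+j}$; $[x,y]=-(-1)^{|x||y|}[y,x]$; and $[x,[y,z]]-(-1)^{|x||y|}[y,[x,z]]=[[x,y],z]$ for homogeneous elements. Given CIF vector subspaces $A_j$ of $V_j$ ($j=0,1$), let $\mathfrak a_j$ be the extension of $A_j$ to $V$: $\lambda_{\mathfrak a_j}=\lambda_{A_j}$, $\rho_{\mathfrak a_j}=\rho_{A_j}$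 on $V_j$, and $\lambda_{\mathfrak a_j}=0$, $\rho_{\mathfrak a_j}=1$ off $V_j$. Then $A_0\oplus A_1$ denotes the CIF set $\mathfrak a_0+\mathfrak a_1$ on $V$ given by $\lambda(x)=\sup_{x=a+b}\{\lambda_{\mathfrak a_0}(a)\wedge\lambda_{\mathfrak a_1}(b)\}$, $\rho(x)=\inf_{x=a+b}\{\rho_{\mathfrak a_0}(a)\vee\rho_{\mathfrak a_1}(b)\}$. A CIF vector subspace $A$ of $V$ is $\mathbb{Z}_2$-graded if $A=A_0\oplus A_1$ for some such $A_0,A_1$. A CIF set $A$ of $V$ is an anti-CIF ideal of $V$ if it is a $\mathbb{Z}_2$-graded CIF vector subspace of $V$ and $\lambda_A(-[x,y])\ge\lambda_A(x)\vee\lambda_A(y)$, $\rho_A(-[x,y])\le\rho_A(x)\wedge\rho_A(y)$ for all $x,y\in V$. An anti-homomorphism of Lie superalgebras $\phi:V\to V'$ is a linear map with $\phi(V_\alpha)\subseteq V'_\alpha$ for $\alpha=0,1$ and $\phi([x,y])=-[\phi(x),\phi(y)]$ for all $x,y\in V$. The image $\phi(A)$ of a CIF set $A$ of $V$ is the CIF set of $V'$ with $\lambda_{\phi(A)}(y)=\sup_{x\in\phi^{-1}(y)}\lambda_A(x)$ and $\rho_{\phi(A)}(y)=\inf_{x\in\phi^{-1}(y)}\rho_A(x)$ for $y\in\phi(V)$ (componentwise sup and inf), and $\lambda_{\phi(A)}(y)=0$, $\rho_{\phi(A)}(y)=1$ for $y\notin\phi(V)$. *)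

theory Defs
  imports Complex_Main "HOL-Library.Product_Order" "HOL-Library.Z2"
begin

section \<open>Lie superalgebras\<close>

text \<open>The sign \<open>(-1)^(|x||y|)\<close> for elements of degrees \<open>|x| = i\<close>, \<open>|y| = j\<close> in
  \<^typ>\<open>bit\<close>, the integers mod 2.\<close>

definition super_sign :: "bit \<Rightarrow> bit \<Rightarrow> 'k::field"
  where "super_sign i j = (if i * j = 1 then -1 else 1)"

locale lie_superalgebra = vector_space scale
  for scale :: "'k::field \<Rightarrow> 'v::ab_group_add \<Rightarrow> 'v" (infixr \<open>*s\<close> 75) +
  fixes V :: "bit \<Rightarrow> 'v set"
    and br :: "'v \<Rightarrow> 'v \<Rightarrow> 'v"
  assumes subspace_grade: "subspace (V i)"
    and grade_sum: "{a + b | a b. a \<in> V 0 \<and> b \<in> V 1} = UNIV"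
    and grade_direct: "V 0 \<inter> V 1 = {0}"
    and linear_br_left: "Vector_Spaces.linear scale scale (\<lambda>x. br x y)"
    and linear_br_right: "Vector_Spaces.linear scale scale (\<lambda>y. br x y)"
    and br_grade: "x \<in> V i \<Longrightarrow> y \<in> V j \<Longrightarrow> br x y \<in> V (i + j)"
    and super_skew: "x \<in> V i \<Longrightarrow> y \<in> V j \<Longrightarrow>
      br x y = - (super_sign i j *s br y x)"
    and super_jacobi: "x \<in> V i \<Longrightarrow> y \<in> V j \<Longrightarrow> z \<in> V k \<Longrightarrow>
      br x (br y z) - super_sign i j *s br y (br x z) = br (br x y) z"

definition lie_superalgebra_anti_hom ::
  "('k::field \<Rightarrow> 'v::ab_group_add \<Rightarrow> 'v) \<Rightarrow> (bit \<Rightarrow> 'v set) \<Rightarrow> ('v \<Rightarrow> 'v \<Rightarrow> 'v) \<Rightarrow>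
   ('k \<Rightarrow> 'w::ab_group_add \<Rightarrow> 'w) \<Rightarrow> (bit \<Rightarrow> 'w set) \<Rightarrow> ('w \<Rightarrow> 'w \<Rightarrow> 'w) \<Rightarrow>
   ('v \<Rightarrow> 'w) \<Rightarrow> bool"
  where "lie_superalgebra_anti_hom scale V br scale' V' br' \<phi> \<longleftrightarrow>
    Vector_Spaces.linear scale scale' \<phi> \<and>
    (\<forall>i. \<phi> ` V i \<subseteq> V' i) \<and>
    (\<forall>x y. \<phi> (br x y) = - br' (\<phi> x) (\<phi> y))"


section \<open>Complex intuitionistic fuzzy sets\<close>

text \<open>The complex number \<open>\<alpha> e^(i 2\<pi> \<beta>)\<close> with \<open>\<alpha>, \<beta> \<in> [0,1]\<close> is represented by the pair
  \<open>(\<alpha>, \<beta>)\<close>, not by an element of \<^typ>\<open>complex\<close>: the phases 0 and 1 have to be kept apart.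
  The theory \<^theory>\<open>HOL-Library.Product_Order\<close> makes \<open>\<le>\<close>, \<open>inf\<close>, \<open>sup\<close>, \<open>Inf\<close> and \<open>Sup\<close>
  componentwise on \<^typ>\<open>real \<times> real\<close>. The values called 1 and 0 are \<open>(1, 1)\<close> and \<open>(0, 0)\<close>.

  For a set \<open>A\<close>, \<open>lam A x = (r x, \<omega> x)\<close> is the membership value and \<open>rho A x\<close> is the
  nonmembership value, with components written with a hat in the usual notation. A CIF set on a
  subset \<open>X\<close> is a pair of total functions of which only the values on \<open>X\<close> matter.\<close>

datatype 'v cif = CIF (lam: "'v \<Rightarrow> real \<times> real") (rho: "'v \<Rightarrow> real \<times> real")

definition cif_set :: "'v set \<Rightarrow> 'v cif \<Rightarrow> bool"
  where "cif_set X A \<longleftrightarrow>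
    (\<forall>x\<in>X. fst (lam A x) \<in> {0..1} \<and> snd (lam A x) \<in> {0..1} \<and>
           fst (rho A x) \<in> {0..1} \<and> snd (rho A x) \<in> {0..1} \<and>
           fst (lam A x) + fst (rho A x) \<le> 1)"

definition cif_homogeneous_with :: "'v cif \<Rightarrow> 'v cif \<Rightarrow> bool"
  where "cif_homogeneous_with A B \<longleftrightarrow>
    (\<forall>x y. (fst (lam A x) \<le> fst (lam B y) \<longleftrightarrow> snd (lam A x) \<le> snd (lam B y)) \<and>
           (fst (rho A x) \<le> fst (rho B y) \<longleftrightarrow> snd (rho A x) \<le> snd (rho B y)))"

definition cif_sum :: "'v::ab_group_add cif \<Rightarrow> 'v cif \<Rightarrow> 'v cif"
  where "cif_sum A B = CIF
    (\<lambda>x. SUP (a, b)\<in>{(a, b). x = a + b}. inf (lam A a) (lam B b))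
    (\<lambda>x. INF (a, b)\<in>{(a, b). x = a + b}. sup (rho A a) (rho B b))"

definition cif_image :: "('v \<Rightarrow> 'w) \<Rightarrow> 'v cif \<Rightarrow> 'w cif"
  where "cif_image \<phi> A = CIF
    (\<lambda>y. if y \<in> range \<phi> then SUP x\<in>\<phi> -` {y}. lam A x else (0, 0))
    (\<lambda>y. if y \<in> range \<phi> then INF x\<in>\<phi> -` {y}. rho A x else (1, 1))"

text \<open>CIF vector subspaces of a linear subspace \<open>W\<close>; the whole space is \<open>W = UNIV\<close>.\<close>

definition cif_subspace ::
  "('k::field \<Rightarrow> 'v::ab_group_add \<Rightarrow> 'v) \<Rightarrow> 'v set \<Rightarrow> 'v cif \<Rightarrow> bool"
  where "cif_subspace scale W A \<longleftrightarrow> cif_set W A \<and>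
    (\<forall>x\<in>W. \<forall>y\<in>W. lam A (x + y) \<ge> inf (lam A x) (lam A y) \<and>
                   rho A (x + y) \<le> sup (rho A x) (rho A y)) \<and>
    (\<forall>c. \<forall>x\<in>W. lam A (scale c x) \<ge> lam A x \<and> rho A (scale c x) \<le> rho A x) \<and>
    lam A 0 = (1, 1) \<and> rho A 0 = (0, 0)"

definition cif_extend :: "'v set \<Rightarrow> 'v cif \<Rightarrow> 'v cif"
  where "cif_extend W A = CIF
    (\<lambda>x. if x \<in> W then lam A x else (0, 0))
    (\<lambda>x. if x \<in> W then rho A x else (1, 1))"

definition cif_direct_sum ::
  "(bit \<Rightarrow> 'v::ab_group_add set) \<Rightarrow> 'v cif \<Rightarrow> 'v cif \<Rightarrow> 'v cif"
  where "cif_direct_sum V A0 A1 = cif_sum (cif_extend (V 0) A0) (cif_extend (V 1) A1)"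

definition cif_graded_subspace ::
  "('k::field \<Rightarrow> 'v::ab_group_add \<Rightarrow> 'v) \<Rightarrow> (bit \<Rightarrow> 'v set) \<Rightarrow> 'v cif \<Rightarrow> bool"
  where "cif_graded_subspace scale V A \<longleftrightarrow> cif_subspace scale UNIV A \<and>
    (\<exists>A0 A1. cif_subspace scale (V 0) A0 \<and> cif_subspace scale (V 1) A1 \<and>
             A = cif_direct_sum V A0 A1)"

definition anti_cif_ideal ::
  "('k::field \<Rightarrow> 'v::ab_group_add \<Rightarrow> 'v) \<Rightarrow> (bit \<Rightarrow> 'v set) \<Rightarrow> ('v \<Rightarrow> 'v \<Rightarrow> 'v) \<Rightarrow>
   'v cif \<Rightarrow> bool"
  where "anti_cif_ideal scale V br A \<longleftrightarrow> cif_graded_subspace scale V A \<and>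
    (\<forall>x y. lam A (- br x y) \<ge> sup (lam A x) (lam A y) \<and>
           rho A (- br x y) \<le> inf (rho A x) (rho A y))"

end

theory Submission
  imports Defs
begin

text \<open>
  Each of the four functions \<open>r\<close>, \<open>\<omega>\<close>, \<open>1 - r^\<close>, \<open>1 - \<omega>^\<close> attached to a CIF set is an ordinary
  fuzzy set with values in \<open>[0,1]\<close>, and sums, images, subspaces and gradings of CIF sets are
  obtained from the sup-min operations on these four fuzzy sets separately. The only condition
  linking them, \<open>r + r^ \<le> 1\<close>, says that the first lies below the third, which monotone operations
  preserve. A fuzzy subspace is graded exactly when its value at a vector is bounded by its values
  at the homogeneous components, and this passes to sums and to images under even maps.
\<close>

section \<open>Fuzzy sets\<close>

definition unit_valued :: "('v \<Rightarrow> real) \<Rightarrow> bool"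
  where "unit_valued f \<longleftrightarrow> (\<forall>x. f x \<in> {0..1})"

definition fuzzy_image :: "('v \<Rightarrow> 'w) \<Rightarrow> ('v \<Rightarrow> real) \<Rightarrow> 'w \<Rightarrow> real"
  where "fuzzy_image \<phi> f y = (SUP x\<in>\<phi> -` {y}. f x)"

text \<open>Written as the image, along the addition map on pairs, of the pointwise minimum, so that
  every fact about images specialises to sums.\<close>

definition fuzzy_sum :: "('v::plus \<Rightarrow> real) \<Rightarrow> ('v \<Rightarrow> real) \<Rightarrow> 'v \<Rightarrow> real"
  where "fuzzy_sum f g = fuzzy_image (\<lambda>(a, b). a + b) (\<lambda>(a, b). min (f a) (g b))"

text \<open>The default 0 serves all four fuzzy sets: a nonmembership value 1 off \<open>W\<close>
  becomes 0 after complementation.\<close>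

definition fuzzy_extend :: "'v set \<Rightarrow> ('v \<Rightarrow> real) \<Rightarrow> 'v \<Rightarrow> real"
  where "fuzzy_extend W f x = (if x \<in> W then f x else 0)"

definition fuzzy_subspace ::
  "('k \<Rightarrow> 'v::ab_group_add \<Rightarrow> 'v) \<Rightarrow> 'v set \<Rightarrow> ('v \<Rightarrow> real) \<Rightarrow> bool"
  where "fuzzy_subspace scale W f \<longleftrightarrow>
    (\<forall>x\<in>W. f x \<in> {0..1}) \<and>
    (\<forall>x\<in>W. \<forall>y\<in>W. min (f x) (f y) \<le> f (x + y)) \<and>
    (\<forall>c. \<forall>x\<in>W. f x \<le> f (scale c x)) \<and> f 0 = 1"

text \<open>A form of gradedness that does not mention the summands. For a fuzzy subspace the
  reverse inequality holds as well, so the value at \<open>a + b\<close> is exactly the minimum of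
  the values at the two components.\<close>

definition fuzzy_graded :: "(bit \<Rightarrow> 'v::plus set) \<Rightarrow> ('v \<Rightarrow> real) \<Rightarrow> bool"
  where "fuzzy_graded V f \<longleftrightarrow> (\<forall>a\<in>V 0. \<forall>b\<in>V 1. f (a + b) \<le> min (f a) (f b))"

definition fuzzy_anti_absorbing :: "('v \<Rightarrow> 'v \<Rightarrow> 'v::uminus) \<Rightarrow> ('v \<Rightarrow> real) \<Rightarrow> bool"
  where "fuzzy_anti_absorbing br f \<longleftrightarrow> (\<forall>x y. max (f x) (f y) \<le> f (- br x y))"

section \<open>Suprema over fibres and sup-min sums of functions into the unit interval\<close>

lemma unit_valued_min:
  "unit_valued f \<Longrightarrow> unit_valued g \<Longrightarrow> unit_valued (\<lambda>(a, b). min (f a) (g b))"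
  by (auto simp: unit_valued_def min_def)

text \<open>Suprema of reals obey the expected laws only for bounded nonempty sets; this supplies
  the bound.\<close>

lemma unit_valued_bdd_above: "unit_valued f \<Longrightarrow> bdd_above (f ` S)"
  by (auto simp: unit_valued_def intro!: bdd_aboveI2[where M = 1])

lemma unit_valued_extend: "(\<And>x. x \<in> W \<Longrightarrow> f x \<in> {0..1}) \<Longrightarrow> unit_valued (fuzzy_extend W f)"
  by (simp add: unit_valued_def fuzzy_extend_def)

lemma fuzzy_subspace_unit_valued: "fuzzy_subspace scale UNIV f \<Longrightarrow> unit_valued f"
  by (simp add: fuzzy_subspace_def unit_valued_def)

lemma fuzzy_subspace_mono: "fuzzy_subspace scale UNIV f \<Longrightarrow> fuzzy_subspace scale W f"
  by (simp add: fuzzy_subspace_def)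

lemma fuzzy_image_ge:
  assumes "unit_valued f"
  shows "f x \<le> fuzzy_image \<phi> f (\<phi> x)"
  unfolding fuzzy_image_def by (rule cSUP_upper) (simp_all add: unit_valued_bdd_above assms)

text \<open>Stands in for a maximum, since the supremum over a fibre need not be attained.
  Surjectivity makes the fibre nonempty.\<close>

lemma fuzzy_image_less:
  assumes "unit_valued f" "surj \<phi>" "c < fuzzy_image \<phi> f y"
  obtains x where "\<phi> x = y" "c < f x"
proof -
  have "\<phi> -` {y} \<noteq> {}"
    using assms(2) by (metis empty_iff surjD vimage_singleton_eq)
  then show ?thesis
    using assms(3) that less_cSUP_iff[OF _ unit_valued_bdd_above[OF assms(1)]]
    unfolding fuzzy_image_def by auto
qed

lemma fuzzy_image_le:
  assumes "unit_valued f" "surj \<phi>" "\<And>x. \<phi> x = y \<Longrightarrow> f x \<le> c"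
  shows "fuzzy_image \<phi> f y \<le> c"
  by (rule ccontr) (use assms in \<open>metis fuzzy_image_less not_le\<close>)

lemma unit_valued_image:
  assumes "unit_valued f" "surj \<phi>"
  shows "unit_valued (fuzzy_image \<phi> f)"
  unfolding unit_valued_def
proof
  fix y
  obtain x where "y = \<phi> x" using assms(2) by blast
  then have "0 \<le> fuzzy_image \<phi> f y"
    using assms(1) fuzzy_image_ge[OF assms(1), of x \<phi>] unfolding unit_valued_def
    by (metis atLeastAtMost_iff order_trans)
  moreover have "fuzzy_image \<phi> f y \<le> 1"
    using assms by (intro fuzzy_image_le) (auto simp: unit_valued_def)
  ultimately show "fuzzy_image \<phi> f y \<in> {0..1}" by simp
qed

lemma fuzzy_image_mono:
  assumes "unit_valued f" "unit_valued g" "surj \<phi>" "\<And>x. f x \<le> g x"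
  shows "fuzzy_image \<phi> f y \<le> fuzzy_image \<phi> g y"
  using assms by (intro fuzzy_image_le) (auto intro: order_trans[OF _ fuzzy_image_ge])

text \<open>Every \<open>x\<close> splits as \<open>x + 0\<close>, so the fibres of addition are
  nonempty and the image lemmas apply to sums.\<close>

lemma surj_plus: "surj (\<lambda>(a, b). a + b :: 'v::monoid_add)"
  by (rule surjI[where f = "\<lambda>x. (x, 0)"]) simp

lemma fuzzy_sum_ge:
  "unit_valued f \<Longrightarrow> unit_valued g \<Longrightarrow> min (f a) (g b) \<le> fuzzy_sum f g (a + b)"
  using fuzzy_image_ge[OF unit_valued_min, of f g "(a, b)" "\<lambda>(a, b). a + b"]
  by (simp add: fuzzy_sum_def)

lemma fuzzy_sum_less:
  fixes f g :: "'v::monoid_add \<Rightarrow> real"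
  assumes "unit_valued f" "unit_valued g" "c < fuzzy_sum f g x"
  obtains a b where "x = a + b" "c < f a" "c < g b"
proof -
  obtain z where "(\<lambda>(a, b). a + b) z = x" "c < (\<lambda>(a, b). min (f a) (g b)) z"
    using assms(3) fuzzy_image_less[OF unit_valued_min[OF assms(1,2)] surj_plus]
    unfolding fuzzy_sum_def by metis
  then show ?thesis using that by (cases z) auto
qed

lemma fuzzy_sum_le:
  fixes f g :: "'v::monoid_add \<Rightarrow> real"
  assumes "unit_valued f" "unit_valued g" "\<And>a b. x = a + b \<Longrightarrow> min (f a) (g b) \<le> c"
  shows "fuzzy_sum f g x \<le> c"
  unfolding fuzzy_sum_def using assms
  by (intro fuzzy_image_le) (auto simp: unit_valued_min surj_plus)

lemma unit_valued_sum:
  fixes f g :: "'v::monoid_add \<Rightarrow> real"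
  shows "unit_valued f \<Longrightarrow> unit_valued g \<Longrightarrow> unit_valued (fuzzy_sum f g)"
  by (simp add: fuzzy_sum_def unit_valued_image unit_valued_min surj_plus)

lemma fuzzy_sum_mono:
  fixes f g :: "'v::monoid_add \<Rightarrow> real"
  assumes "unit_valued f" "unit_valued g" "unit_valued f'" "unit_valued g'"
    and "\<And>x. f x \<le> f' x" "\<And>x. g x \<le> g' x"
  shows "fuzzy_sum f g x \<le> fuzzy_sum f' g' x"
  unfolding fuzzy_sum_def using assms
  by (intro fuzzy_image_mono)
     (auto simp: unit_valued_min surj_plus intro!: min.mono)

text \<open>A decomposition of a preimage of \<open>y\<close> maps to a decomposition of
  \<open>y\<close>; conversely, preimages of the two summands of \<open>y\<close> can be chosen
  independently, and their sum is a preimage of \<open>y\<close>.\<close>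

lemma fuzzy_image_sum:
  fixes \<phi> :: "'v::monoid_add \<Rightarrow> 'w::monoid_add"
  assumes f: "unit_valued f" and g: "unit_valued g" and "surj \<phi>"
    and add: "\<And>x y. \<phi> (x + y) = \<phi> x + \<phi> y"
  shows "fuzzy_image \<phi> (fuzzy_sum f g) = fuzzy_sum (fuzzy_image \<phi> f) (fuzzy_image \<phi> g)"
    (is "?L = ?R")
proof
  note U = unit_valued_sum[OF f g] unit_valued_image[OF f \<open>surj \<phi>\<close>]
    unit_valued_image[OF g \<open>surj \<phi>\<close>]
  fix y
  show "?L y = ?R y"
  \<comment> \<open>Each inequality is tested on the numbers \<open>c\<close> strictly below its
    left side, for which actual points with values above \<open>c\<close> exist.\<close>
  proof (rule antisym; rule dense_le)
    fix c assume "c < ?L y"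
    then obtain x where x: "\<phi> x = y" "c < fuzzy_sum f g x"
      by (rule fuzzy_image_less[OF U(1) \<open>surj \<phi>\<close>])
    from x(2) obtain a b where ab: "x = a + b" "c < f a" "c < g b"
      by (rule fuzzy_sum_less[OF f g])
    have "c \<le> min (fuzzy_image \<phi> f (\<phi> a)) (fuzzy_image \<phi> g (\<phi> b))"
      using ab fuzzy_image_ge[OF f, of a \<phi>] fuzzy_image_ge[OF g, of b \<phi>] by simp
    also have "\<dots> \<le> ?R (\<phi> a + \<phi> b)" by (rule fuzzy_sum_ge[OF U(2,3)])
    finally show "c \<le> ?R y" using x ab add by simp
  next
    fix c assume "c < ?R y"
    then obtain u v where uv: "y = u + v" "c < fuzzy_image \<phi> f u" "c < fuzzy_image \<phi> g v"
      by (rule fuzzy_sum_less[OF U(2,3)])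
    obtain a where a: "\<phi> a = u" "c < f a"
      using uv(2) by (rule fuzzy_image_less[OF f \<open>surj \<phi>\<close>])
    obtain b where b: "\<phi> b = v" "c < g b"
      using uv(3) by (rule fuzzy_image_less[OF g \<open>surj \<phi>\<close>])
    have "c \<le> fuzzy_sum f g (a + b)"
      using fuzzy_sum_ge[OF f g, of a b] a b by simp
    also have "\<dots> \<le> ?L (\<phi> (a + b))" by (rule fuzzy_image_ge[OF U(1)])
    finally show "c \<le> ?L y" using uv a b add by simp
  qed
qed

section \<open>Fuzzy subspaces under sums and linear images\<close>

text \<open>Near-optimal decompositions of \<open>x\<close> and \<open>y\<close> add up summand by
  summand to a decomposition of \<open>x + y\<close>, and a decomposition of \<open>x\<close> can be
  scaled termwise.\<close>

lemma fuzzy_subspace_sum: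
  assumes "vector_space scale"
    and f: "fuzzy_subspace scale UNIV f" and g: "fuzzy_subspace scale UNIV g"
  shows "fuzzy_subspace scale UNIV (fuzzy_sum f g)"
proof -
  interpret vector_space scale by fact
  note U = fuzzy_subspace_unit_valued[OF f] fuzzy_subspace_unit_valued[OF g]
  have plus: "min (fuzzy_sum f g x) (fuzzy_sum f g y) \<le> fuzzy_sum f g (x + y)" for x y
  proof (rule dense_le)
    fix c assume "c < min (fuzzy_sum f g x) (fuzzy_sum f g y)"
    then have cx: "c < fuzzy_sum f g x" and cy: "c < fuzzy_sum f g y" by auto
    obtain a b where ab: "x = a + b" "c < f a" "c < g b"
      using cx by (rule fuzzy_sum_less[OF U])
    obtain a' b' where ab': "y = a' + b'" "c < f a'" "c < g b'"
      using cy by (rule fuzzy_sum_less[OF U])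
    have "min (f a) (f a') \<le> f (a + a')" "min (g b) (g b') \<le> g (b + b')"
      using f g by (auto simp: fuzzy_subspace_def)
    then have "c \<le> min (f (a + a')) (g (b + b'))"
      using ab ab' by auto
    also have "\<dots> \<le> fuzzy_sum f g ((a + a') + (b + b'))" by (rule fuzzy_sum_ge[OF U])
    finally show "c \<le> fuzzy_sum f g (x + y)" by (simp add: ab ab' algebra_simps)
  qed
  have scale: "fuzzy_sum f g x \<le> fuzzy_sum f g (scale c x)" for c x
  proof (rule fuzzy_sum_le[OF U])
    fix a b assume x: "x = a + b"
    have "min (f a) (g b) \<le> min (f (scale c a)) (g (scale c b))"
      using f g by (intro min.mono) (auto simp: fuzzy_subspace_def)
    also have "\<dots> \<le> fuzzy_sum f g (scale c a + scale c b)" by (rule fuzzy_sum_ge[OF U])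
    finally show "min (f a) (g b) \<le> fuzzy_sum f g (scale c x)"
      by (simp add: x scale_right_distrib)
  qed
  have unit: "fuzzy_sum f g x \<in> {0..1}" for x
    using unit_valued_sum[OF U] unfolding unit_valued_def by blast
  \<comment> \<open>The decomposition \<open>0 = 0 + 0\<close> already gives the value 1.\<close>
  moreover have "1 \<le> fuzzy_sum f g 0"
    using fuzzy_sum_ge[OF U, of 0 0] f g by (simp add: fuzzy_subspace_def)
  ultimately have "fuzzy_sum f g 0 = 1"
    by (metis antisym atLeastAtMost_iff)
  with unit plus scale show ?thesis by (simp add: fuzzy_subspace_def)
qed

lemma fuzzy_subspace_image:
  assumes lin: "Vector_Spaces.linear scale scale' \<phi>" and "surj \<phi>"
    and f: "fuzzy_subspace scale UNIV f"
  shows "fuzzy_subspace scale' UNIV (fuzzy_image \<phi> f)"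
proof -
  interpret Vector_Spaces.linear scale scale' \<phi> by fact
  note U = fuzzy_subspace_unit_valued[OF f]
  have plus: "min (fuzzy_image \<phi> f x) (fuzzy_image \<phi> f y) \<le> fuzzy_image \<phi> f (x + y)" for x y
  proof (rule dense_le)
    fix c assume "c < min (fuzzy_image \<phi> f x) (fuzzy_image \<phi> f y)"
    then have cx: "c < fuzzy_image \<phi> f x" and cy: "c < fuzzy_image \<phi> f y" by auto
    obtain a where a: "\<phi> a = x" "c < f a"
      using cx by (rule fuzzy_image_less[OF U \<open>surj \<phi>\<close>])
    obtain b where b: "\<phi> b = y" "c < f b"
      using cy by (rule fuzzy_image_less[OF U \<open>surj \<phi>\<close>])
    have "min (f a) (f b) \<le> f (a + b)"
      using f by (auto simp: fuzzy_subspace_def)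
    then have "c \<le> f (a + b)" using a b by auto
    also have "\<dots> \<le> fuzzy_image \<phi> f (\<phi> (a + b))" by (rule fuzzy_image_ge[OF U])
    finally show "c \<le> fuzzy_image \<phi> f (x + y)" by (simp add: a b add)
  qed
  have scale: "fuzzy_image \<phi> f x \<le> fuzzy_image \<phi> f (scale' c x)" for c x
  proof (rule fuzzy_image_le[OF U \<open>surj \<phi>\<close>])
    fix a assume a: "\<phi> a = x"
    have "f a \<le> f (scale c a)" using f by (auto simp: fuzzy_subspace_def)
    also have "\<dots> \<le> fuzzy_image \<phi> f (\<phi> (scale c a))" by (rule fuzzy_image_ge[OF U])
    finally show "f a \<le> fuzzy_image \<phi> f (scale' c x)" by (simp add: a local.scale)
  qed
  have unit: "fuzzy_image \<phi> f x \<in> {0..1}" for x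
    using unit_valued_image[OF U \<open>surj \<phi>\<close>] unfolding unit_valued_def by blast
  moreover have "1 \<le> fuzzy_image \<phi> f 0"
    using fuzzy_image_ge[OF U, of 0 \<phi>] f by (simp add: fuzzy_subspace_def zero)
  ultimately have "fuzzy_image \<phi> f 0 = 1"
    by (metis antisym atLeastAtMost_iff)
  with unit plus scale show ?thesis by (simp add: fuzzy_subspace_def)
qed

section \<open>Gradings and bracket absorption under sums and even maps\<close>

context lie_superalgebra
begin

lemma homogeneous_components:
  obtains a b where "a \<in> V 0" "b \<in> V 1" "x = a + b"
  using grade_sum by blast

text \<open>The difference \<open>a' - a = b - b'\<close> lies in both graded parts, hence is
  0.\<close>

lemma homogeneous_components_unique:
  assumes "a \<in> V 0" "b \<in> V 1" "a' \<in> V 0" "b' \<in> V 1" "a + b = a' + b'"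
  shows "a' = a" "b' = b"
proof -
  have "a' - a = b - b'" using assms(5) by (simp add: algebra_simps)
  then have "a' - a \<in> V 0 \<inter> V 1"
    using assms subspace_diff[OF subspace_grade] by (metis IntI)
  then show "a' = a" using grade_direct by simp
  then show "b' = b" using assms(5) by simp
qed

text \<open>Only the homogeneous decomposition matters in the supremum: any other one has a summand
  outside its graded part, where the extension is 0, and \<open>min (f a) (g b)\<close> is
  nonnegative.\<close>

lemma fuzzy_sum_extend:
  assumes f: "\<And>x. x \<in> V 0 \<Longrightarrow> f x \<in> {0..1}" and g: "\<And>x. x \<in> V 1 \<Longrightarrow> g x \<in> {0..1}"
    and a: "a \<in> V 0" and b: "b \<in> V 1"
  shows "fuzzy_sum (fuzzy_extend (V 0) f) (fuzzy_extend (V 1) g) (a + b) = min (f a) (g b)"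
    (is "fuzzy_sum ?f ?g _ = _")
proof (rule antisym)
  have U: "unit_valued ?f" "unit_valued ?g"
    by (simp_all only: unit_valued_extend f g)
  show "fuzzy_sum ?f ?g (a + b) \<le> min (f a) (g b)"
  proof (rule fuzzy_sum_le[OF U])
    fix a' b' assume eq: "a + b = a' + b'"
    show "min (?f a') (?g b') \<le> min (f a) (g b)"
    proof (cases "a' \<in> V 0 \<and> b' \<in> V 1")
      case True
      then show ?thesis
        using homogeneous_components_unique[OF a b _ _ eq] by (simp add: fuzzy_extend_def)
    next
      case False
      then have "min (?f a') (?g b') \<le> 0" by (auto simp: fuzzy_extend_def)
      also have "0 \<le> min (f a) (g b)" using f[OF a] g[OF b] by simp
      finally show ?thesis .
    qed
  qed
  show "min (f a) (g b) \<le> fuzzy_sum ?f ?g (a + b)"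
    using fuzzy_sum_ge[OF U, of a b] a b by (simp add: fuzzy_extend_def)
qed

text \<open>The restrictions of \<open>f\<close> itself to the two graded parts serve as summands:
  gradedness bounds \<open>f x\<close> above by the minimum over the components, and the subspace
  property bounds it below.\<close>

lemma fuzzy_graded_decomp:
  assumes f: "fuzzy_subspace scale UNIV f" and gr: "fuzzy_graded V f"
  shows "fuzzy_sum (fuzzy_extend (V 0) f) (fuzzy_extend (V 1) f) = f"
proof
  fix x
  have unit: "f x \<in> {0..1}" for x using f by (simp add: fuzzy_subspace_def)
  obtain a b where ab: "a \<in> V 0" "b \<in> V 1" "x = a + b" by (rule homogeneous_components)
  have "f x = min (f a) (f b)"
    using gr f ab unfolding fuzzy_graded_def fuzzy_subspace_def by (intro antisym) auto
  then show "fuzzy_sum (fuzzy_extend (V 0) f) (fuzzy_extend (V 1) f) x = f x"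
    using fuzzy_sum_extend[OF unit unit ab(1,2)] ab(3) by simp
qed

text \<open>Since \<open>f 0 = g 0 = 1\<close>, a zero component does not lower the minimum. The
  direct sum therefore restricts to \<open>f\<close> on \<open>V 0\<close> and to \<open>g\<close>
  on \<open>V 1\<close>.\<close>

lemma fuzzy_graded_direct_sum:
  assumes f: "fuzzy_subspace scale (V 0) f" and g: "fuzzy_subspace scale (V 1) g"
  shows "fuzzy_graded V (fuzzy_sum (fuzzy_extend (V 0) f) (fuzzy_extend (V 1) g))"
    (is "fuzzy_graded V ?h")
  unfolding fuzzy_graded_def
proof (intro ballI)
  fix a b assume ab: "a \<in> V 0" "b \<in> V 1"
  have unit: "\<And>x. x \<in> V 0 \<Longrightarrow> f x \<in> {0..1}" "\<And>x. x \<in> V 1 \<Longrightarrow> g x \<in> {0..1}"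
    and one: "f 0 = 1" "g 0 = 1"
    using f g by (simp_all add: fuzzy_subspace_def)
  have h: "?h (x + y) = min (f x) (g y)" if "x \<in> V 0" "y \<in> V 1" for x y
    using fuzzy_sum_extend[OF unit that] .
  have "?h a = f a" "?h b = g b"
    using h[OF ab(1) subspace_0[OF subspace_grade]] h[OF subspace_0[OF subspace_grade] ab(2)]
      unit(1)[OF ab(1)] unit(2)[OF ab(2)] one by simp_all
  then show "?h (a + b) \<le> min (?h a) (?h b)" using h[OF ab] by simp
qed

text \<open>If \<open>a + b = x + y\<close>, the even components of \<open>x\<close> and
  \<open>y\<close> add up to \<open>a\<close> and the odd ones to \<open>b\<close>. These
  decompositions of \<open>a\<close> and \<open>b\<close> have values at least as large as that of
  \<open>x + y\<close>.\<close>

lemma fuzzy_graded_sum: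
  assumes U: "unit_valued f" "unit_valued g" and gr: "fuzzy_graded V f" "fuzzy_graded V g"
  shows "fuzzy_graded V (fuzzy_sum f g)"
  unfolding fuzzy_graded_def
proof (intro ballI)
  fix a b assume a: "a \<in> V 0" and b: "b \<in> V 1"
  show "fuzzy_sum f g (a + b) \<le> min (fuzzy_sum f g a) (fuzzy_sum f g b)"
  proof (rule fuzzy_sum_le[OF U])
    fix x y assume xy: "a + b = x + y"
    obtain x0 x1 where x: "x0 \<in> V 0" "x1 \<in> V 1" "x = x0 + x1"
      by (rule homogeneous_components)
    obtain y0 y1 where y: "y0 \<in> V 0" "y1 \<in> V 1" "y = y0 + y1"
      by (rule homogeneous_components)
    have "a + b = (x0 + y0) + (x1 + y1)" using xy x y by (simp add: algebra_simps)
    then have "x0 + y0 = a" "x1 + y1 = b"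
      using homogeneous_components_unique[OF a b] x y subspace_add[OF subspace_grade] by metis+
    then have "min (f x0) (g y0) \<le> fuzzy_sum f g a" "min (f x1) (g y1) \<le> fuzzy_sum f g b"
      using fuzzy_sum_ge[OF U] by metis+
    moreover have "f x \<le> min (f x0) (f x1)" "g y \<le> min (g y0) (g y1)"
      using gr x y by (auto simp: fuzzy_graded_def)
    ultimately show "min (f x) (g y) \<le> min (fuzzy_sum f g a) (fuzzy_sum f g b)" by linarith
  qed
qed

text \<open>By additivity of the bracket in each argument, \<open>x = a + b\<close> yields the
  decomposition \<open>- br a z + - br b z\<close> of \<open>- br x z\<close>, and likewise on the
  other side.\<close>

lemma fuzzy_anti_absorbing_sum:
  assumes U: "unit_valued f" "unit_valued g"
    and ab: "fuzzy_anti_absorbing br f" "fuzzy_anti_absorbing br g"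
  shows "fuzzy_anti_absorbing br (fuzzy_sum f g)"
proof -
  have left: "br (x + y) z = br x z + br y z" for x y z
    using linear_br_left Vector_Spaces.linear.axioms(3) module_hom.add by metis
  have right: "br z (x + y) = br z x + br z y" for x y z
    using linear_br_right Vector_Spaces.linear.axioms(3) module_hom.add by metis
  have f: "f x \<le> f (- br x z)" "f x \<le> f (- br z x)"
    and g: "g x \<le> g (- br x z)" "g x \<le> g (- br z x)" for x z
    using ab by (auto simp: fuzzy_anti_absorbing_def)
  have "fuzzy_sum f g x \<le> fuzzy_sum f g (- br x z)" for x z
  proof (rule fuzzy_sum_le[OF U])
    fix a b assume x: "x = a + b"
    have "min (f a) (g b) \<le> min (f (- br a z)) (g (- br b z))" by (intro min.mono f g)
    also have "\<dots> \<le> fuzzy_sum f g (- br a z + - br b z)" by (rule fuzzy_sum_ge[OF U])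
    finally show "min (f a) (g b) \<le> fuzzy_sum f g (- br x z)" by (simp add: x left)
  qed
  moreover have "fuzzy_sum f g x \<le> fuzzy_sum f g (- br z x)" for x z
  proof (rule fuzzy_sum_le[OF U])
    fix a b assume x: "x = a + b"
    have "min (f a) (g b) \<le> min (f (- br z a)) (g (- br z b))" by (intro min.mono f g)
    also have "\<dots> \<le> fuzzy_sum f g (- br z a + - br z b)" by (rule fuzzy_sum_ge[OF U])
    finally show "min (f a) (g b) \<le> fuzzy_sum f g (- br z x)" by (simp add: x right)
  qed
  ultimately show ?thesis by (simp add: fuzzy_anti_absorbing_def)
qed

end

text \<open>As \<phi> preserves degrees, the components of any preimage of \<open>a + b\<close> are
  preimages of \<open>a\<close> and \<open>b\<close>, by uniqueness of components in the
  target.\<close>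

lemma fuzzy_graded_image:
  assumes V: "lie_superalgebra scale V br" and V': "lie_superalgebra scale' V' br'"
    and hom: "lie_superalgebra_anti_hom scale V br scale' V' br' \<phi>" and "surj \<phi>"
    and U: "unit_valued f" and gr: "fuzzy_graded V f"
  shows "fuzzy_graded V' (fuzzy_image \<phi> f)"
  unfolding fuzzy_graded_def
proof (intro ballI)
  interpret Vector_Spaces.linear scale scale' \<phi>
    using hom by (simp add: lie_superalgebra_anti_hom_def)
  fix a b assume ab: "a \<in> V' 0" "b \<in> V' 1"
  show "fuzzy_image \<phi> f (a + b) \<le> min (fuzzy_image \<phi> f a) (fuzzy_image \<phi> f b)"
  proof (rule fuzzy_image_le[OF U \<open>surj \<phi>\<close>])
    fix x assume x: "\<phi> x = a + b"
    obtain x0 x1 where x01: "x0 \<in> V 0" "x1 \<in> V 1" "x = x0 + x1"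
      by (rule lie_superalgebra.homogeneous_components[OF V])
    have "a + b = \<phi> x0 + \<phi> x1" using x x01 by (simp add: add)
    moreover have "\<phi> x0 \<in> V' 0" "\<phi> x1 \<in> V' 1"
      using hom x01 by (auto simp: lie_superalgebra_anti_hom_def)
    ultimately have "\<phi> x0 = a" "\<phi> x1 = b"
      using lie_superalgebra.homogeneous_components_unique[OF V' ab] by metis+
    then have "f x0 \<le> fuzzy_image \<phi> f a" "f x1 \<le> fuzzy_image \<phi> f b"
      using fuzzy_image_ge[OF U] by metis+
    moreover have "f x \<le> min (f x0) (f x1)"
      using gr x01 by (auto simp: fuzzy_graded_def)
    ultimately show "f x \<le> min (fuzzy_image \<phi> f a) (fuzzy_image \<phi> f b)" by linarith
  qed
qed

text \<open>A preimage of \<open>- br' (\<phi> x) (\<phi> y)\<close> is \<open>br x y\<close>,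
  without the minus sign, whereas absorption bounds \<open>f (- br x y)\<close>. Scaling by -1
  inside the fuzzy subspace passes from one to the other.\<close>

lemma fuzzy_anti_absorbing_image:
  assumes hom: "lie_superalgebra_anti_hom scale V br scale' V' br' \<phi>" and "surj \<phi>"
    and f: "fuzzy_subspace scale UNIV f" and ab: "fuzzy_anti_absorbing br f"
  shows "fuzzy_anti_absorbing br' (fuzzy_image \<phi> f)"
proof -
  interpret Vector_Spaces.linear scale scale' \<phi>
    using hom by (simp add: lie_superalgebra_anti_hom_def)
  note U = fuzzy_subspace_unit_valued[OF f]
  have br: "\<phi> (br x y) = - br' (\<phi> x) (\<phi> y)" for x y
    using hom by (simp add: lie_superalgebra_anti_hom_def)
  have "f (- br x y) \<le> f (scale (-1) (- br x y))" for x y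
    using f unfolding fuzzy_subspace_def by blast
  then have "f (- br x y) \<le> f (br x y)" for x y by simp
  then have f_br: "f x \<le> f (br x y)" "f y \<le> f (br x y)" for x y
    using ab unfolding fuzzy_anti_absorbing_def by (meson max.bounded_iff order_trans)+
  have le: "f x \<le> fuzzy_image \<phi> f (- br' (\<phi> x) (\<phi> y))" "f y \<le> fuzzy_image \<phi> f (- br' (\<phi> x) (\<phi> y))"
    for x y
    using order_trans[OF f_br(1) fuzzy_image_ge[OF U]] order_trans[OF f_br(2) fuzzy_image_ge[OF U]]
    unfolding br[symmetric] by blast+
  have "fuzzy_image \<phi> f u \<le> fuzzy_image \<phi> f (- br' u v)" for u v
  proof (rule fuzzy_image_le[OF U \<open>surj \<phi>\<close>])
    fix x assume "\<phi> x = u"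
    moreover obtain y where "\<phi> y = v" using \<open>surj \<phi>\<close> by (metis surjD)
    ultimately show "f x \<le> fuzzy_image \<phi> f (- br' u v)" using le by blast
  qed
  moreover have "fuzzy_image \<phi> f v \<le> fuzzy_image \<phi> f (- br' u v)" for u v
  proof (rule fuzzy_image_le[OF U \<open>surj \<phi>\<close>])
    fix y assume "\<phi> y = v"
    moreover obtain x where "\<phi> x = u" using \<open>surj \<phi>\<close> by (metis surjD)
    ultimately show "f y \<le> fuzzy_image \<phi> f (- br' u v)" using le by blast
  qed
  ultimately show ?thesis by (simp add: fuzzy_anti_absorbing_def)
qed


section \<open>The four fuzzy sets of a CIF set\<close>

text \<open>The flag \<open>m\<close> selects membership or (complemented) nonmembership, \<open>p\<close> phase or modulus.\<close>

definition component :: "bool \<Rightarrow> bool \<Rightarrow> 'v cif \<Rightarrow> 'v \<Rightarrow> real"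
  where "component m p A x =
    (let pr = if p then snd else fst in if m then pr (lam A x) else 1 - pr (rho A x))"

lemma cif_eqI:
  assumes "\<And>m p. component m p A = component m p B"
  shows "A = B"
proof (rule cif.expand, rule conjI; rule ext)
  fix x
  have *: "component m p A x = component m p B x" for m p using assms by simp
  show "lam A x = lam B x"
    using *[of True True] *[of True False] by (simp add: component_def prod_eq_iff)
  show "rho A x = rho B x"
    using *[of False True] *[of False False] by (simp add: component_def prod_eq_iff)
qed

lemma cif_set_iff_component:
  "cif_set W A \<longleftrightarrow> (\<forall>m p. \<forall>x\<in>W. component m p A x \<in> {0..1}) \<and>
    (\<forall>x\<in>W. component True False A x \<le> component False False A x)"
  unfolding cif_set_def component_def all_bool_eq by fastforce

lemma cif_set_unit_valued: "cif_set UNIV A \<Longrightarrow> unit_valued (component m p A)"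
  by (auto simp: cif_set_iff_component unit_valued_def)

text \<open>Complementation reverses the inequalities for nonmembership, so all four components
  satisfy the same conditions; \<open>rho A 0 = (0, 0)\<close> turns into the value 1 at 0.\<close>

lemma cif_subspace_iff_component:
  "cif_subspace scale W A \<longleftrightarrow> (\<forall>m p. fuzzy_subspace scale W (component m p A)) \<and>
    (\<forall>x\<in>W. component True False A x \<le> component False False A x)"
  unfolding cif_subspace_def cif_set_iff_component fuzzy_subspace_def component_def all_bool_eq
  by (simp add: less_eq_prod_def inf_prod_def sup_prod_def inf_real_def sup_real_def prod_eq_iff
      min_le_iff_disj le_max_iff_disj ball_conj_distrib all_conj_distrib conj_ac)

lemma anti_absorbing_iff_component:
  "(\<forall>x y. lam A (- br x y) \<ge> sup (lam A x) (lam A y) \<and>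
          rho A (- br x y) \<le> inf (rho A x) (rho A y)) \<longleftrightarrow>
    (\<forall>m p. fuzzy_anti_absorbing br (component m p A))"
  unfolding fuzzy_anti_absorbing_def component_def all_bool_eq
  by (simp add: less_eq_prod_def) blast

lemma component_extend: "component m p (cif_extend W A) = fuzzy_extend W (component m p A)"
  by (auto simp: component_def cif_extend_def fuzzy_extend_def)

section \<open>Components of images, sums and direct sums\<close>

text \<open>Turns the infima that define nonmembership into suprema of the complements, as
  \<open>1 - u\<close> reverses the order.\<close>

lemma one_minus_INF:
  fixes f :: "'a \<Rightarrow> real"
  assumes "S \<noteq> {}" "bdd_below (f ` S)"
  shows "1 - (INF x\<in>S. f x) = (SUP x\<in>S. 1 - f x)"
proof (rule antisym)
  obtain m where "\<And>x. x \<in> S \<Longrightarrow> m \<le> f x"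
    using assms(2) by (auto simp: bdd_below_def)
  then have bdd: "bdd_above ((\<lambda>x. 1 - f x) ` S)"
    by (intro bdd_aboveI2[where M = "1 - m"]) simp
  have "1 - (SUP x\<in>S. 1 - f x) \<le> (INF x\<in>S. f x)"
    using assms(1) cSUP_upper[OF _ bdd] by (intro cINF_greatest) (auto simp: algebra_simps)
  then show "1 - (INF x\<in>S. f x) \<le> (SUP x\<in>S. 1 - f x)" by simp
  show "(SUP x\<in>S. 1 - f x) \<le> 1 - (INF x\<in>S. f x)"
    using assms by (intro cSUP_least) (auto intro: cINF_lower)
qed

text \<open>With \<phi> surjective, the default branch of \<open>cif_image\<close> never occurs and
  the suprema and infima range over nonempty fibres.\<close>

lemma component_image:
  assumes "cif_set UNIV A" "surj \<phi>"
  shows "component m p (cif_image \<phi> A) = fuzzy_image \<phi> (component m p A)"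
proof
  fix y
  have ne: "\<phi> -` {y} \<noteq> {}" using assms(2) by (metis empty_iff surjD vimage_singleton_eq)
  have "bdd_below ((\<lambda>x. fst (rho A x)) ` S)" "bdd_below ((\<lambda>x. snd (rho A x)) ` S)" for S
    using assms(1) by (auto simp: cif_set_def intro!: bdd_belowI2[where m = 0])
  then show "component m p (cif_image \<phi> A) y = fuzzy_image \<phi> (component m p A) y"
    using assms(2) ne
    by (simp add: component_def cif_image_def fuzzy_image_def fst_Sup snd_Sup fst_Inf snd_Inf
        image_image one_minus_INF)
qed

lemma component_sum:
  fixes A B :: "'v::ab_group_add cif"
  assumes "cif_set UNIV A" "cif_set UNIV B"
  shows "component m p (cif_sum A B) = fuzzy_sum (component m p A) (component m p B)"
proof
  fix x :: 'v
  let ?S = "{(a, b). x = a + b}"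
  have ne: "?S \<noteq> {}" by (auto intro: exI[of _ x] exI[of _ 0])
  have eq: "(\<lambda>(a, b). a + b) -` {x} = ?S" by auto
  have bdd: "bdd_below ((\<lambda>z. max (fst (rho A (fst z))) (fst (rho B (snd z)))) ` ?S)"
    "bdd_below ((\<lambda>z. max (snd (rho A (fst z))) (snd (rho B (snd z)))) ` ?S)"
    using assms by (auto simp: cif_set_def le_max_iff_disj intro!: bdd_belowI2[where m = 0])
  \<comment> \<open>For nonmembership, complementing an infimum of maxima thus gives a supremum of
    minima.\<close>
  have max: "1 - max u v = min (1 - u) (1 - v)" for u v :: real by (simp add: max_def min_def)
  show "component m p (cif_sum A B) x = fuzzy_sum (component m p A) (component m p B) x"
    using one_minus_INF[OF ne bdd(1)] one_minus_INF[OF ne bdd(2)]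
    by (simp add: component_def cif_sum_def fuzzy_sum_def fuzzy_image_def eq fst_Sup snd_Sup
        fst_Inf snd_Inf image_image case_prod_beta inf_real_def sup_real_def max)
qed

lemma cif_set_extend: "cif_set W A \<Longrightarrow> cif_set UNIV (cif_extend W A)"
  by (auto simp: cif_set_def cif_extend_def)

lemma component_direct_sum:
  assumes "cif_set (V 0) A" "cif_set (V 1) B"
  shows "component m p (cif_direct_sum V A B) =
    fuzzy_sum (fuzzy_extend (V 0) (component m p A)) (fuzzy_extend (V 1) (component m p B))"
  using assms by (simp add: cif_direct_sum_def component_sum component_extend cif_set_extend)

text \<open>Removes the existential over the summands: any direct sum has graded components, and
  conversely \<open>A\<close> can take the place of both \<open>A0\<close> and \<open>A1\<close>,
  because only its values on \<open>V 0\<close> and \<open>V 1\<close> enter the extensions.\<close>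

lemma (in lie_superalgebra) cif_graded_subspace_iff_component:
  "cif_graded_subspace scale V A \<longleftrightarrow>
    cif_subspace scale UNIV A \<and> (\<forall>m p. fuzzy_graded V (component m p A))"
proof (intro iffI conjI)
  assume gr: "cif_graded_subspace scale V A"
  then show "cif_subspace scale UNIV A" by (simp add: cif_graded_subspace_def)
  from gr obtain A0 A1 where sub: "cif_subspace scale (V 0) A0" "cif_subspace scale (V 1) A1"
    and A: "A = cif_direct_sum V A0 A1"
    unfolding cif_graded_subspace_def by blast
  then have "cif_set (V 0) A0" "cif_set (V 1) A1" by (simp_all add: cif_subspace_def)
  then show "\<forall>m p. fuzzy_graded V (component m p A)"
    using sub unfolding A cif_subspace_iff_component
    by (simp add: component_direct_sum fuzzy_graded_direct_sum)
next
  assume *: "cif_subspace scale UNIV A \<and> (\<forall>m p. fuzzy_graded V (component m p A))"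
  then have fs: "fuzzy_subspace scale UNIV (component m p A)" for m p
    by (simp add: cif_subspace_iff_component)
  have sub: "cif_subspace scale W A" for W
    using * by (simp add: cif_subspace_iff_component fuzzy_subspace_mono)
  then have set: "cif_set W A" for W by (simp add: cif_subspace_def)
  have "A = cif_direct_sum V A A"
  proof (rule cif_eqI)
    fix m p
    show "component m p A = component m p (cif_direct_sum V A A)"
      using * fuzzy_graded_decomp[OF fs] by (simp add: component_direct_sum set)
  qed
  then show "cif_graded_subspace scale V A"
    unfolding cif_graded_subspace_def using sub by blast
qed

lemma (in lie_superalgebra) anti_cif_ideal_iff_component:
  "anti_cif_ideal scale V br A \<longleftrightarrow>
    (\<forall>m p. fuzzy_subspace scale UNIV (component m p A) \<and> fuzzy_graded V (component m p A) \<and>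
           fuzzy_anti_absorbing br (component m p A)) \<and>
    (\<forall>x. component True False A x \<le> component False False A x)"
  unfolding anti_cif_ideal_def cif_graded_subspace_iff_component cif_subspace_iff_component
    anti_absorbing_iff_component by auto

lemma anti_cif_ideal_cif_set: "anti_cif_ideal scale V br A \<Longrightarrow> cif_set UNIV A"
  by (simp add: anti_cif_ideal_def cif_graded_subspace_def cif_subspace_def)


section \<open>Sums and images of anti-CIF ideals\<close>

text \<open>The conditions on single components come from the fuzzy lemmas; the inequality linking
  the two moduli is preserved because the sup-min sum is monotone.\<close>

lemma (in lie_superalgebra) anti_cif_ideal_sum:
  assumes A: "anti_cif_ideal scale V br A" and B: "anti_cif_ideal scale V br B"
  shows "anti_cif_ideal scale V br (cif_sum A B)"
proof -
  note set = anti_cif_ideal_cif_set[OF A] anti_cif_ideal_cif_set[OF B]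
  note U = cif_set_unit_valued[OF set(1)] cif_set_unit_valued[OF set(2)]
  show ?thesis
    using A B unfolding anti_cif_ideal_iff_component component_sum[OF set]
    by (auto intro!: fuzzy_subspace_sum[OF vector_space_axioms] fuzzy_graded_sum
        fuzzy_anti_absorbing_sum fuzzy_sum_mono U)
qed

lemma anti_cif_ideal_image:
  assumes V: "lie_superalgebra scale V br" and V': "lie_superalgebra scale' V' br'"
    and hom: "lie_superalgebra_anti_hom scale V br scale' V' br' \<phi>" and "surj \<phi>"
    and A: "anti_cif_ideal scale V br A"
  shows "anti_cif_ideal scale' V' br' (cif_image \<phi> A)"
proof -
  note set = anti_cif_ideal_cif_set[OF A]
  note U = cif_set_unit_valued[OF set]
  have lin: "Vector_Spaces.linear scale scale' \<phi>"
    using hom by (simp add: lie_superalgebra_anti_hom_def)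
  show ?thesis
    using A unfolding lie_superalgebra.anti_cif_ideal_iff_component[OF V]
      lie_superalgebra.anti_cif_ideal_iff_component[OF V'] component_image[OF set \<open>surj \<phi>\<close>]
    by (auto intro!: fuzzy_subspace_image[OF lin \<open>surj \<phi>\<close>]
        fuzzy_graded_image[OF V V' hom \<open>surj \<phi>\<close>]
        fuzzy_anti_absorbing_image[OF hom \<open>surj \<phi>\<close>] fuzzy_image_mono \<open>surj \<phi>\<close> U)
qed

text \<open>The assumptions on the sum and the images allow \<open>component_image\<close> and
  \<open>component_sum\<close> to be applied to the nested expressions on both sides.\<close>

lemma cif_image_sum:
  fixes \<phi> :: "'v::ab_group_add \<Rightarrow> 'w::ab_group_add"
  assumes A: "cif_set UNIV A" and B: "cif_set UNIV B" and AB: "cif_set UNIV (cif_sum A B)"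
    and images: "cif_set UNIV (cif_image \<phi> A)" "cif_set UNIV (cif_image \<phi> B)"
    and "surj \<phi>" "\<And>x y. \<phi> (x + y) = \<phi> x + \<phi> y"
  shows "cif_image \<phi> (cif_sum A B) = cif_sum (cif_image \<phi> A) (cif_image \<phi> B)"
  by (rule cif_eqI)
    (simp add: assms component_image component_sum fuzzy_image_sum cif_set_unit_valued)

theorem theorem4p5:
  fixes scale :: "'k::field \<Rightarrow> 'v::ab_group_add \<Rightarrow> 'v"
    and V :: "bit \<Rightarrow> 'v set"
    and br :: "'v \<Rightarrow> 'v \<Rightarrow> 'v"
    and scale' :: "'k \<Rightarrow> 'w::ab_group_add \<Rightarrow> 'w"
    and V' :: "bit \<Rightarrow> 'w set"
    and br' :: "'w \<Rightarrow> 'w \<Rightarrow> 'w"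
    and \<phi> :: "'v \<Rightarrow> 'w"
    and A B :: "'v cif"
  assumes "lie_superalgebra scale V br"
    and "lie_superalgebra scale' V' br'"
    and "lie_superalgebra_anti_hom scale V br scale' V' br' \<phi>"
    and "surj \<phi>"
    and "anti_cif_ideal scale V br A"
    and "anti_cif_ideal scale V br B"
    and "cif_homogeneous_with A B"
  shows "cif_image \<phi> (cif_sum A B) = cif_sum (cif_image \<phi> A) (cif_image \<phi> B) \<and>
    anti_cif_ideal scale' V' br' (cif_image \<phi> (cif_sum A B))"
proof
  note sets = anti_cif_ideal_cif_set[OF assms(5)] anti_cif_ideal_cif_set[OF assms(6)]
  have sum: "anti_cif_ideal scale V br (cif_sum A B)"
    using assms(1,5,6) by (rule lie_superalgebra.anti_cif_ideal_sum)
  \<comment> \<open>Applied to \<open>A\<close> and \<open>B\<close> this shows that their images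
    are CIF sets, as the first claim requires; applied to the sum it is the second claim.\<close>
  note image = anti_cif_ideal_image[OF assms(1-4)]
  have "\<phi> (x + y) = \<phi> x + \<phi> y" for x y
    using assms(3) module_hom.add[OF Vector_Spaces.linear.axioms(3)]
    by (auto simp: lie_superalgebra_anti_hom_def)
  then show "cif_image \<phi> (cif_sum A B) = cif_sum (cif_image \<phi> A) (cif_image \<phi> B)"
    by (intro cif_image_sum anti_cif_ideal_cif_set[OF sum] anti_cif_ideal_cif_set[OF image]
        sets assms(4-6))
  show "anti_cif_ideal scale' V' br' (cif_image \<phi> (cif_sum A B))"
    using sum by (rule image)
qed

end
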